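(* For each $i=1,\dots,n$, let $A_i\subset\mathbb{R}^n$ be a compact convex set whose interior is non-empty and let $f_i:\mathbb{R}^n\times S^n\to\mathbb{R}$ be continuous. Assume that, for every $i=1,\dots,n$, every boundary point $x$ of $A_i$ and every supporting hyperplane $H$ of $A_i$ at $x$, the set $A_i\cap H$ is a singleton. Assume moreover that $f_i(x,-\mathbf{u})=-f_i(x,\mathbf{u})$ for all $(x,\mathbf{u})\in\mathbb{R}^n\times S^n$ and all $i=1,\dots,n$. Then there exists some $\mathbf{u}\in S^n$ such that for each $i=1,\dots,n$ either (i) or (ii) below holds. (i) Both $A_i\cap H_{\mathbf{u}}^+$ and $A_i\cap H_{\mathbf{u}}^-$ are non-empty, and $$\max_{x\in A_i\cap H_{\mathbf{u}}^+}f_i(x,\mathbf{u})-\min_{x\in A_i\cap H_{\mathbf{u}}^+}f_i(x,\mathbf{u})=\max_{x\in A_i\cap H_{\mathbf{u}}^-}f_i(x,\mathbf{u})-\min_{x\in A_i\cap H_{\mathbf{u}}^-}f_i(x,\mathbf{u}).$$ (ii) One of $A_i\cap H_{\mathbf{u}}^+$ and $A_i\cap H_{\mathbf{u}}^-$ is empty, and the other is $A_i$. Further, $f_i(\cdot,\mathbf{u})$ is constant on $A_i$.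
   Context: $S^n$ is the unit sphere in $\mathbb{R}^{n+1}$. A point $\mathbf{u}=(u_1,\dots,u_n,u_{n+1})\in S^n$ is written $\mathbf{u}=(u,u_{n+1})$ with $u=(u_1,\dots,u_n)\in\mathbb{R}^n$, and $H_{\mathbf{u}}^+=\{x\in\mathbb{R}^n\mid\langle u,x\rangle\ge u_{n+1}\}$, $H_{\mathbf{u}}^-=\{x\in\mathbb{R}^n\mid\langle u,x\rangle\le u_{n+1}\}$, where $\langle u,x\rangle=u_1x_1+\cdots+u_nx_n$. (If $u=0$, one of these two sets is $\mathbb{R}^n$ and the other is empty.) *)

theory Defs
  imports "HOL-Analysis.Analysis"
begin

text \<open>
  A point of \<open>\<real>\<^sup>n\<^sup>+\<^sup>1\<close> is split as \<open>(u, u\<^sub>n\<^sub>+\<^sub>1)\<close>, i.e. as an element of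
  \<open>(real ^ 'n) \<times> real\<close>. The library norm on this product is the Euclidean one, so
  \<open>sphere 0 1\<close> in this type is the unit sphere \<open>S\<^sup>n\<close>.
\<close>

definition pos_halfspace :: "(real ^ 'n) \<times> real \<Rightarrow> (real ^ 'n) set" where
  "pos_halfspace u = {x. fst u \<bullet> x \<ge> snd u}"

definition neg_halfspace :: "(real ^ 'n) \<times> real \<Rightarrow> (real ^ 'n) set" where
  "neg_halfspace u = {x. fst u \<bullet> x \<le> snd u}"

text \<open>
  One inequality suffices below, since \<open>a\<close> and \<open>b\<close> may both be negated.
\<close>

definition supporting_hyperplane ::
    "'a::euclidean_space set \<Rightarrow> 'a \<Rightarrow> 'a set \<Rightarrow> bool" where
  "supporting_hyperplane A x H \<longleftrightarrow>
     (\<exists>a b. a \<noteq> 0 \<and> H = {y. a \<bullet> y = b} \<and> x \<in> A \<inter> H \<and> (\<forall>y\<in>A. a \<bullet> y \<le> b))"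

text \<open>
  Attained maximum and minimum of a function on a possibly infinite set (the library's
  \<open>Max\<close> and \<open>Min\<close> are for finite sets only). If there is no greatest or least value,
  the result is unspecified; on a non-empty compact set a continuous function has both.
\<close>

definition max_on :: "'a set \<Rightarrow> ('a \<Rightarrow> real) \<Rightarrow> real" where
  "max_on S g = (GREATEST t. t \<in> g ` S)"

definition min_on :: "'a set \<Rightarrow> ('a \<Rightarrow> real) \<Rightarrow> real" where
  "min_on S g = (LEAST t. t \<in> g ` S)"

lemma max_on_eqI:
  assumes "x \<in> S" "\<And>y. y \<in> S \<Longrightarrow> g y \<le> g x"
  shows "max_on S g = g x"
  unfolding max_on_def using assms by (intro Greatest_equality) auto

lemma min_on_eqI:
  assumes "x \<in> S" "\<And>y. y \<in> S \<Longrightarrow> g x \<le> g y"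
  shows "min_on S g = g x"
  unfolding min_on_def using assms by (intro Least_equality) auto

end

theory Submission
  imports Defs "HOL-Homology.Homology"
begin

text \<open>
  Fix \<open>i\<close> and let \<open>h\<^sub>i(u)\<close> be the oscillation (maximum minus minimum) of \<open>f\<^sub>i(\<cdot>, u)\<close> over the slice
  \<open>A\<^sub>i \<inter> H\<^sub>u\<^sup>+\<close>, with the value \<open>0\<close> on an empty slice. Since \<open>H\<^sub>u\<^sup>- = H\<^bsub>-u\<^esub>\<^sup>+\<close> and an oscillation does not
  change when the function is negated, oddness of \<open>f\<^sub>i\<close> makes \<open>h\<^sub>i(-u)\<close> the oscillation of
  \<open>f\<^sub>i(\<cdot>, u)\<close> over \<open>A\<^sub>i \<inter> H\<^sub>u\<^sup>-\<close>. So \<open>u \<mapsto> (h\<^sub>i(u) - h\<^sub>i(-u))\<^sub>i\<close> is an odd map from \<open>S\<^sup>n\<close> to \<open>\<real>\<^sup>n\<close>. If it is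
  continuous, the Borsuk--Ulam theorem gives it a zero \<open>u\<close>. For each \<open>i\<close> the two slices at \<open>u\<close> then have
  equal oscillation, which is (i) when both are non-empty; when one is empty, the other one is \<open>A\<^sub>i\<close>
  and has oscillation \<open>0\<close>, which is (ii).

  Continuity of \<open>h\<^sub>i\<close> is where the condition on supporting hyperplanes enters
  (\<open>continuous_on_spread_pos_halfspace\<close>). Upper semicontinuity is compactness. Lower
  semicontinuity could fail only where the hyperplane merely touches \<open>A\<^sub>i\<close>, since there the slice can
  vanish under a small perturbation; but there the slice is a single point, so its oscillation is
  already \<open>0\<close>, the value on the empty slice.

  The Borsuk--Ulam theorem is proved by Ky Fan's parity argument, carried out on singular chains
  rather than on a triangulation. Because the homology of \<open>S\<^sup>n\<close> vanishes in the degrees strictly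
  between \<open>0\<close> and \<open>n\<close> (and the reduced homology in degree \<open>0\<close>), there are chains
  \<open>c\<^sub>0, \<dots>, c\<^sub>n\<close>, with \<open>c\<^sub>0\<close> a point, such that the boundary of \<open>c\<^bsub>d+1\<^esub>\<close> is \<open>c\<^sub>d\<close> plus or minus its antipodal
  image; they play the role of nested hemispheres. Barycentric subdivision preserves these
  relations, so the simplices can be taken arbitrarily small (\<open>fine_antipodal_tower_exists\<close>). An odd
  map \<open>g\<close> to \<open>\<real>\<^sup>n\<close> without zeros labels each point by the index and sign of its dominant coordinate.
  This labelling takes values in \<open>\<plusminus>1, \<dots>, \<plusminus>n\<close>, is odd, and never gives opposite labels to two vertices
  of a small simplex. Counting modulo 2 then forces an odd number of simplices of \<open>c\<^sub>n\<close> to carry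
  \<open>n + 1\<close> labels of distinct absolute values
  (\<open>antipodal_tower_has_alternating_simplex\<close>), and there are only \<open>n\<close> such values.
\<close>

section \<open>Alternating sets of labels\<close>

text \<open>
  When the absolute values in \<open>L\<close> are distinct, this says that the signs alternate as the elements
  of \<open>L\<close> are listed by increasing absolute value, starting with the sign \<open>s\<close>.
\<close>

definition alternating :: "int \<Rightarrow> int set \<Rightarrow> bool" where
  "alternating s L \<longleftrightarrow> (\<forall>x\<in>L. sgn x = s * (- 1) ^ card {y \<in> L. \<bar>y\<bar> < \<bar>x\<bar>})"

lemma alternating_empty [simp]: "alternating s {}"
  by (simp add: alternating_def)

lemma alternating_insert_max:
  assumes "finite L" and "\<And>y. y \<in> L \<Longrightarrow> \<bar>y\<bar> < \<bar>m\<bar>"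
  shows "alternating s (insert m L) \<longleftrightarrow> alternating s L \<and> sgn m = s * (- 1) ^ card L"
proof -
  have "{y \<in> insert m L. \<bar>y\<bar> < \<bar>m\<bar>} = L"
    using assms by auto
  moreover have "{y \<in> insert m L. \<bar>y\<bar> < \<bar>x\<bar>} = {y \<in> L. \<bar>y\<bar> < \<bar>x\<bar>}" if "x \<in> L" for x
    using assms(2)[OF that] by auto
  ultimately show ?thesis
    by (auto simp: alternating_def)
qed

lemma alternating_uminus_image: "alternating s (uminus ` L) \<longleftrightarrow> alternating (- s) L"
proof -
  have "{y \<in> uminus ` L. \<bar>y\<bar> < \<bar>x\<bar>} = uminus ` {y \<in> L. \<bar>y\<bar> < \<bar>x\<bar>}" for x
    by auto
  then have "card {y \<in> uminus ` L. \<bar>y\<bar> < \<bar>x\<bar>} = card {y \<in> L. \<bar>y\<bar> < \<bar>x\<bar>}" for x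
    by (simp add: card_image)
  moreover have "- sgn x = s * c \<longleftrightarrow> sgn x = - s * c" for x c :: int
    by auto
  ultimately show ?thesis
    by (simp add: alternating_def sgn_minus)
qed

text \<open>
  The combinatorial core of Ky Fan's lemma: an alternating set has exactly one facet that alternates
  from the sign \<open>s\<close> (drop the last element or the first one), and any other set has none or two.
  Modulo 2 this follows by adding the element \<open>m\<close> of largest absolute value. If its sign continues
  the pattern of \<open>s\<close> on all of \<open>L\<close>, only the facet without \<open>m\<close> can alternate; otherwise the facets
  containing \<open>m\<close> alternate exactly when the corresponding facets of \<open>L\<close> do, and the induction
  hypothesis counts these.
\<close>

lemma even_alternating_facets:
  fixes L :: "int set"
  assumes "finite L" and "0 \<notin> L" and "inj_on abs L" and s: "s = 1 \<or> s = - 1"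
  shows "even ((\<Sum>x\<in>L. of_bool (alternating s (L - {x}))) +
               of_bool (alternating s L) + of_bool (alternating (- s) L) :: int)"
  using assms(1-3)
proof (induction L rule: finite_ranking_induct[where f = abs])
  case empty
  then show ?case by simp
next
  case (insert m L)
  show ?case
  proof (cases "m \<in> L")
    case True
    with insert show ?thesis by (simp add: insert_absorb)
  next
    case False
    have less: "\<bar>y\<bar> < \<bar>m\<bar>" if "y \<in> L" for y
    proof -
      have "\<bar>y\<bar> \<noteq> \<bar>m\<bar>"
        using inj_onD[OF insert.prems(2), of y m] that False by blast
      with insert.hyps(2)[OF that] show ?thesis by linarith
    qed
    have sgn: "sgn m = 1 \<or> sgn m = - 1"
      using insert.prems(1) by (auto simp: sgn_if)
    have "s * (- 1) ^ card L = 1 \<or> s * (- 1) ^ card L = - 1"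
      using s by (cases "even (card L)") auto
    moreover have "a = - b \<longleftrightarrow> a \<noteq> b" if "a = 1 \<or> a = - 1" "b = 1 \<or> b = - 1" for a b :: int
      using that by auto
    ultimately have flip: "sgn m = - (s * (- 1) ^ card L) \<longleftrightarrow> sgn m \<noteq> s * (- 1) ^ card L"
      using sgn by blast
    have IH: "even ((\<Sum>x\<in>L. of_bool (alternating s (L - {x}))) +
               of_bool (alternating s L) + of_bool (alternating (- s) L) :: int)"
      using insert by auto
    have facet: "alternating s (insert m L - {x}) \<longleftrightarrow>
        alternating s (L - {x}) \<and> sgn m \<noteq> s * (- 1) ^ card L" if "x \<in> L" for x
    proof -
      have "insert m L - {x} = insert m (L - {x})"
        using that False by auto
      moreover have "s * (- 1) ^ card (L - {x}) = - (s * (- 1) ^ card L)"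
        using card.remove[OF insert.hyps(1) that] by simp
      moreover have "alternating s (insert m (L - {x})) \<longleftrightarrow>
          alternating s (L - {x}) \<and> sgn m = s * (- 1) ^ card (L - {x})"
        using insert.hyps(1) less by (intro alternating_insert_max) auto
      ultimately show ?thesis
        using flip by simp
    qed
    have "insert m L - {m} = L"
      using False by simp
    then have "(\<Sum>x\<in>insert m L. of_bool (alternating s (insert m L - {x}))) =
        of_bool (alternating s L) + (\<Sum>x\<in>L. of_bool (alternating s (insert m L - {x})) :: int)"
      using insert.hyps(1) False by simp
    also have "(\<Sum>x\<in>L. of_bool (alternating s (insert m L - {x})) :: int) =
        (if sgn m = s * (- 1) ^ card L then 0 else \<Sum>x\<in>L. of_bool (alternating s (L - {x})))"
      using facet by (auto intro!: sum.cong)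
    finally have sum: "(\<Sum>x\<in>insert m L. of_bool (alternating s (insert m L - {x})) :: int) =
        of_bool (alternating s L) +
        (if sgn m = s * (- 1) ^ card L then 0 else \<Sum>x\<in>L. of_bool (alternating s (L - {x})))" .
    have ins: "alternating t (insert m L) \<longleftrightarrow> alternating t L \<and> sgn m = t * (- 1) ^ card L" for t
      using insert.hyps(1) less by (rule alternating_insert_max)
    have "sgn m = - s * (- 1) ^ card L \<longleftrightarrow> sgn m \<noteq> s * (- 1) ^ card L"
      using flip by simp
    with IH show ?thesis
      unfolding sum ins by (cases "alternating s L"; cases "alternating (- s) L") simp_all
  qed
qed

definition alternating_family :: "int \<Rightarrow> 'i set \<Rightarrow> ('i \<Rightarrow> int) \<Rightarrow> bool" where
  "alternating_family s I l \<longleftrightarrow> inj_on l I \<and> alternating s (l ` I)"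

lemma alternating_family_cong:
  assumes "\<And>i. i \<in> I \<Longrightarrow> l i = l' i"
  shows "alternating_family s I l \<longleftrightarrow> alternating_family s I l'"
  using assms by (simp add: alternating_family_def cong: inj_on_cong image_cong)

text \<open>
  The same count for the labels of the vertices of a simplex, where labels may repeat. If
  \<open>l i = l j\<close> with \<open>i \<noteq> j\<close>, a facet with distinct labels must omit \<open>i\<close> or \<open>j\<close>, and these two facets carry
  the same labels, so their contributions cancel modulo 2.
\<close>

lemma even_alternating_subfamilies:
  fixes l :: "'i \<Rightarrow> int"
  assumes I: "finite I" and nz: "\<And>i. i \<in> I \<Longrightarrow> l i \<noteq> 0"
    and compl: "\<And>i j. i \<in> I \<Longrightarrow> j \<in> I \<Longrightarrow> l i \<noteq> - l j"
    and s: "s = 1 \<or> s = - 1"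
  shows "even ((\<Sum>k\<in>I. of_bool (alternating_family s (I - {k}) l)) +
               of_bool (alternating_family s I l) + of_bool (alternating_family (- s) I l) :: int)"
proof (cases "inj_on l I")
  case True
  have "inj_on abs (l ` I)"
    using compl by (auto simp: inj_on_def abs_eq_iff)
  moreover have "0 \<notin> l ` I"
    using nz by auto
  ultimately have "even ((\<Sum>x\<in>l ` I. of_bool (alternating s (l ` I - {x}))) +
      of_bool (alternating s (l ` I)) + of_bool (alternating (- s) (l ` I)) :: int)"
    using I s by (intro even_alternating_facets) auto
  moreover have "(\<Sum>x\<in>l ` I. of_bool (alternating s (l ` I - {x}))) =
      (\<Sum>k\<in>I. of_bool (alternating_family s (I - {k}) l) :: int)"
    unfolding sum.reindex[OF True] 
    using True by (intro sum.cong) (auto simp: alternating_family_def inj_on_image_set_diff[OF True] inj_on_diff)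
  ultimately show ?thesis
    using True by (simp add: alternating_family_def)
next
  case False
  then obtain i j where ij: "i \<in> I" "j \<in> I" "i \<noteq> j" "l i = l j"
    by (auto simp: inj_on_def)
  have other: "\<not> alternating_family s (I - {k}) l" if "k \<notin> {i, j}" for k
    using ij that by (auto simp: alternating_family_def inj_on_def)
  have "l j \<in> l ` (I - {i})" "l i \<in> l ` (I - {j})"
    using ij(1-3) by blast+
  then have "insert (l j) (l ` (I - {i})) = l ` (I - {i})" "insert (l i) (l ` (I - {j})) = l ` (I - {j})"
    by (simp_all add: insert_absorb)
  moreover have "l ` I = insert (l i) (l ` (I - {i}))" "l ` I = insert (l j) (l ` (I - {j}))"
    using ij by auto
  ultimately have img: "l ` (I - {i}) = l ` I" "l ` (I - {j}) = l ` I"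
    using ij(4) by simp_all
  have "inj_on l (I - {i}) \<longleftrightarrow> inj_on l (I - {j})"
    using I ij img by (simp add: inj_on_iff_eq_card)
  then have same: "alternating_family s (I - {i}) l \<longleftrightarrow> alternating_family s (I - {j}) l"
    by (simp add: alternating_family_def img)
  have "(\<Sum>k\<in>I. of_bool (alternating_family s (I - {k}) l) :: int) =
      (\<Sum>k\<in>{i, j}. of_bool (alternating_family s (I - {k}) l))"
    using I ij other by (intro sum.mono_neutral_right) auto
  also have "\<dots> = 2 * of_bool (alternating_family s (I - {i}) l)"
    using ij same by simp
  finally show ?thesis
    using False by (simp add: alternating_family_def)
qed

section \<open>Labelled singular chains\<close>

text \<open>
  The pairing of an integral cochain \<open>w\<close> with a chain, i.e. the linear extension of \<open>w\<close>. Chains on the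
  one-point set stand for the integers, so that linearity is inherited from \<open>frag_extend\<close>.
\<close>

definition evaluate :: "('b \<Rightarrow> int) \<Rightarrow> ('b \<Rightarrow>\<^sub>0 int) \<Rightarrow> int" where
  "evaluate w c = Poly_Mapping.lookup (frag_extend (\<lambda>\<sigma>. frag_cmul (w \<sigma>) (frag_of ())) c) ()"

lemma evaluate_0 [simp]: "evaluate w 0 = 0"
  by (simp add: evaluate_def)

lemma evaluate_of [simp]: "evaluate w (frag_of \<sigma>) = w \<sigma>"
  by (simp add: evaluate_def)

lemma evaluate_cmul [simp]: "evaluate w (frag_cmul k c) = k * evaluate w c"
  by (simp add: evaluate_def frag_extend_cmul)

lemma evaluate_add [simp]: "evaluate w (a + b) = evaluate w a + evaluate w b"
  by (simp add: evaluate_def frag_extend_add lookup_add)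

lemma evaluate_diff [simp]: "evaluate w (a - b) = evaluate w a - evaluate w b"
  by (simp add: evaluate_def frag_extend_diff lookup_minus)

lemma evaluate_sum: "finite I \<Longrightarrow> evaluate w (sum c I) = (\<Sum>i\<in>I. evaluate w (c i))"
  by (induction I rule: finite_induct) auto

abbreviation vertex :: "nat \<Rightarrow> nat \<Rightarrow> real" where
  "vertex i \<equiv> (\<lambda>j. if j = i then 1 else 0)"

abbreviation antipode :: "(nat \<Rightarrow> real) \<Rightarrow> nat \<Rightarrow> real" where
  "antipode x \<equiv> (\<lambda>i. - x i)"

definition alternating_weight ::
    "('a \<Rightarrow> int) \<Rightarrow> int \<Rightarrow> nat \<Rightarrow> ((nat \<Rightarrow> real) \<Rightarrow> 'a) \<Rightarrow> int" where
  "alternating_weight lab s p \<sigma> = of_bool (alternating_family s {..p} (\<lambda>i. lab (\<sigma> (vertex i))))"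

lemma simplical_face_vertex:
  "simplical_face k (vertex i) = vertex (if i < k then i else Suc i)"
  by (auto simp: simplical_face_def fun_eq_iff)

lemma alternating_weight_singular_face:
  assumes "k \<le> Suc p"
  shows "alternating_weight lab s p (singular_face (Suc p) k \<sigma>) =
    of_bool (alternating_family s ({..Suc p} - {k}) (\<lambda>i. lab (\<sigma> (vertex i))))"
proof -
  define skip where "skip i = (if i < k then i else Suc i)" for i
  define l where "l i = lab (\<sigma> (vertex i))" for i
  have inj: "inj_on skip {..p}"
    by (auto simp: skip_def inj_on_def)
  have img: "skip ` {..p} = {..Suc p} - {k}"
  proof
    show "skip ` {..p} \<subseteq> {..Suc p} - {k}"
      by (auto simp: skip_def)
    show "{..Suc p} - {k} \<subseteq> skip ` {..p}"
    proof
      fix i assume "i \<in> {..Suc p} - {k}"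
      then show "i \<in> skip ` {..p}"
        using assms by (cases "i < k") (auto simp: skip_def image_iff intro: bexI[of _ i] bexI[of _ "i - 1"])
    qed
  qed
  have "singular_face (Suc p) k \<sigma> (vertex i) = \<sigma> (vertex (skip i))" if "i \<le> p" for i
    using that by (simp add: singular_face_def simplical_face_vertex skip_def)
  then have "alternating_weight lab s p (singular_face (Suc p) k \<sigma>) =
      of_bool (alternating_family s {..p} (\<lambda>i. l (skip i)))"
    unfolding alternating_weight_def l_def
    by (intro arg_cong[where f = of_bool] alternating_family_cong) simp
  moreover have "alternating_family s {..p} (\<lambda>i. l (skip i)) \<longleftrightarrow> alternating_family s (skip ` {..p}) l"
    using comp_inj_on_iff[OF inj, of l] by (simp add: alternating_family_def image_image comp_def)
  ultimately show ?thesis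
    unfolding img l_def by simp
qed

lemma alternating_weight_antipode:
  assumes "singular_simplex p X \<sigma>" and "\<And>x. x \<in> topspace X \<Longrightarrow> lab (antipode x) = - lab x"
  shows "alternating_weight lab s p (simplex_map p antipode \<sigma>) = alternating_weight lab (- s) p \<sigma>"
proof -
  have "\<sigma> (vertex i) \<in> topspace X" if "i \<le> p" for i
    using assms(1) that by (auto simp: singular_simplex_def continuous_map_def Pi_iff)
  then have eq: "lab (simplex_map p antipode \<sigma> (vertex i)) = - lab (\<sigma> (vertex i))" if "i \<le> p" for i
    using that assms(2) by (simp add: simplex_map_def)
  have "(\<lambda>i. lab (simplex_map p antipode \<sigma> (vertex i))) ` {..p} =
      uminus ` (\<lambda>i. lab (\<sigma> (vertex i))) ` {..p}"
    by (auto simp: eq image_image intro!: image_cong)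
  moreover have "inj_on (\<lambda>i. lab (simplex_map p antipode \<sigma> (vertex i))) {..p} \<longleftrightarrow>
      inj_on (\<lambda>i. lab (\<sigma> (vertex i))) {..p}"
    by (auto simp: inj_on_def eq)
  ultimately show ?thesis
    by (simp add: alternating_weight_def alternating_family_def alternating_uminus_image)
qed

lemma evaluate_alternating_weight_antipode:
  assumes "singular_chain p X c" and "\<And>x. x \<in> topspace X \<Longrightarrow> lab (antipode x) = - lab x"
  shows "evaluate (alternating_weight lab s p) (chain_map p antipode c) =
    evaluate (alternating_weight lab (- s) p) c"
  using assms(1) unfolding singular_chain_def
proof (induction c rule: frag_induction)
  case (one \<sigma>)
  then show ?case
    using alternating_weight_antipode[where X = X and lab = lab] assms(2) by simp
qed (auto simp: chain_map_diff)

text \<open>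
  On simplices without opposite or zero labels, the coboundary of the cochain counting simplices
  that alternate from \<open>+\<close> agrees modulo 2 with the cochain counting all alternating simplices. The signs in the
  boundary formula disappear modulo 2, which leaves the count of alternating facets.
\<close>

lemma even_evaluate_chain_boundary:
  fixes c :: "'a chain"
  assumes nz: "\<And>\<sigma> i. \<sigma> \<in> Poly_Mapping.keys c \<Longrightarrow> i \<le> Suc p \<Longrightarrow> lab (\<sigma> (vertex i)) \<noteq> 0"
    and compl: "\<And>\<sigma> i j. \<sigma> \<in> Poly_Mapping.keys c \<Longrightarrow> i \<le> Suc p \<Longrightarrow> j \<le> Suc p \<Longrightarrow>
                  lab (\<sigma> (vertex i)) \<noteq> - lab (\<sigma> (vertex j))"
  shows "even (evaluate (alternating_weight lab 1 p) (chain_boundary (Suc p) c) +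
               evaluate (alternating_weight lab 1 (Suc p)) c +
               evaluate (alternating_weight lab (- 1) (Suc p)) c)"
proof -
  have "Poly_Mapping.keys c \<subseteq> {\<sigma>. (\<forall>i\<le>Suc p. lab (\<sigma> (vertex i)) \<noteq> 0) \<and>
      (\<forall>i\<le>Suc p. \<forall>j\<le>Suc p. lab (\<sigma> (vertex i)) \<noteq> - lab (\<sigma> (vertex j)))}" (is "_ \<subseteq> ?G")
    using assms by auto
  then show ?thesis
  proof (induction c rule: frag_induction)
    case (one \<sigma>)
    let ?l = "\<lambda>i. lab (\<sigma> (vertex i))"
    let ?w = "\<lambda>k. of_bool (alternating_family 1 ({..Suc p} - {k}) ?l) :: int"
    have "evaluate (alternating_weight lab 1 p) (chain_boundary (Suc p) (frag_of \<sigma>)) =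
        (\<Sum>k\<le>Suc p. (- 1) ^ k * ?w k)"
      unfolding chain_boundary_of
      by (simp add: evaluate_sum alternating_weight_singular_face del: sum.atMost_Suc)
    moreover have "even ((\<Sum>k\<le>Suc p. (- 1) ^ k * ?w k) - (\<Sum>k\<le>Suc p. ?w k))"
    proof -
      have "even ((- 1) ^ k * ?w k - ?w k)" for k
        by (cases "even k") auto
      then show ?thesis
        unfolding sum_subtractf[symmetric] by (intro dvd_sum) auto
    qed
    moreover have "even ((\<Sum>k\<in>{..Suc p}. ?w k) + of_bool (alternating_family 1 {..Suc p} ?l) +
        of_bool (alternating_family (- 1) {..Suc p} ?l) :: int)"
      using one by (intro even_alternating_subfamilies) auto
    ultimately show ?case
      unfolding evaluate_of alternating_weight_def by presburger
  next
    case (diff a b)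
    then show ?case
      unfolding chain_boundary_diff evaluate_diff by presburger
  qed auto
qed

text \<open>
  A chain-level substitute for the filtration of the sphere by hemispheres of increasing dimension:
  the boundary of a hemisphere is a sphere, made of the next smaller hemisphere and its antipode. The sign
  \<open>(- 1) ^ d\<close> is the one that makes the right-hand side a cycle. Only the chains up to degree \<open>m\<close> are
  constrained.
\<close>

definition antipodal_tower :: "nat \<Rightarrow> nat \<Rightarrow> (nat \<Rightarrow> (nat \<Rightarrow> real) chain) \<Rightarrow> bool" where
  "antipodal_tower n m c \<longleftrightarrow>
     (\<exists>\<sigma>. c 0 = frag_of \<sigma>) \<and>
     (\<forall>d\<le>m. singular_chain d (nsphere n) (c d)) \<and>
     (\<forall>d<m. chain_boundary (Suc d) (c (Suc d)) =
             c d - frag_cmul ((- 1) ^ d) (chain_map d antipode (c d)))"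

lemma antipodal_towerD:
  assumes "antipodal_tower n m c"
  shows "d \<le> m \<Longrightarrow> singular_chain d (nsphere n) (c d)"
    and "d < m \<Longrightarrow> chain_boundary (Suc d) (c (Suc d)) =
             c d - frag_cmul ((- 1) ^ d) (chain_map d antipode (c d))"
  using assms by (auto simp: antipodal_tower_def)

text \<open>
  Ky Fan's lemma. The number of alternating simplices of \<open>c d\<close>, counted with multiplicity, is odd for
  every \<open>d\<close>: it is \<open>1\<close> for the point \<open>c 0\<close>, and by the coboundary formula the number for \<open>c (Suc d)\<close> has
  the parity of the number of simplices alternating from \<open>+\<close> in \<open>c d\<close> and in its antipodal image.
  The antipode exchanges the two starting signs, so these are just the alternating simplices of
  \<open>c d\<close>.
\<close>

theorem antipodal_tower_has_alternating_simplex: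
  assumes tower: "antipodal_tower n m c"
    and lab_minus: "\<And>x. x \<in> topspace (nsphere n) \<Longrightarrow> lab (antipode x) = - lab x"
    and nz: "\<And>x. x \<in> topspace (nsphere n) \<Longrightarrow> lab x \<noteq> 0"
    and compl: "\<And>d \<sigma> i j. d \<le> m \<Longrightarrow> \<sigma> \<in> Poly_Mapping.keys (c d) \<Longrightarrow> i \<le> d \<Longrightarrow> j \<le> d \<Longrightarrow>
                  lab (\<sigma> (vertex i)) \<noteq> - lab (\<sigma> (vertex j))"
  shows "\<exists>\<sigma>\<in>Poly_Mapping.keys (c m). \<exists>s. alternating_family s {..m} (\<lambda>i. lab (\<sigma> (vertex i)))"
proof -
  have on_sphere: "\<sigma> (vertex i) \<in> topspace (nsphere n)"
    if "\<sigma> \<in> Poly_Mapping.keys (c d)" "d \<le> m" "i \<le> d" for \<sigma> d i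
  proof -
    have "singular_simplex d (nsphere n) \<sigma>"
      using antipodal_towerD(1)[OF tower that(2)] that(1) by (auto simp: singular_chain_def)
    then show ?thesis
      using that(3) by (auto simp: singular_simplex_def continuous_map_def Pi_iff)
  qed
  have "odd (evaluate (alternating_weight lab 1 d) (c d) +
             evaluate (alternating_weight lab (- 1) d) (c d))" if "d \<le> m" for d
    using that
  proof (induction d)
    case 0
    obtain \<sigma> where \<sigma>: "c 0 = frag_of \<sigma>"
      using tower by (auto simp: antipodal_tower_def)
    then have "lab (\<sigma> (vertex 0)) \<noteq> 0"
      using on_sphere[of \<sigma> 0 0] nz by simp
    moreover have "alternating s {a} \<longleftrightarrow> sgn a = s" for s a
      using alternating_insert_max[of "{}" a s] by simp
    ultimately show ?case
      by (simp add: \<sigma> alternating_weight_def alternating_family_def sgn_if)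
  next
    case (Suc d)
    have "evaluate (alternating_weight lab 1 d) (chain_boundary (Suc d) (c (Suc d))) =
        evaluate (alternating_weight lab 1 d) (c d) -
        (- 1) ^ d * evaluate (alternating_weight lab (- 1) d) (c d)"
      using Suc.prems antipodal_towerD[OF tower]
      by (simp add: evaluate_alternating_weight_antipode[where X = "nsphere n" and lab = lab] lab_minus)
    moreover have "even (evaluate (alternating_weight lab 1 d) (chain_boundary (Suc d) (c (Suc d))) +
        evaluate (alternating_weight lab 1 (Suc d)) (c (Suc d)) +
        evaluate (alternating_weight lab (- 1) (Suc d)) (c (Suc d)))"
      using Suc.prems on_sphere nz compl by (intro even_evaluate_chain_boundary) auto
    moreover have "odd (evaluate (alternating_weight lab 1 d) (c d) +
        evaluate (alternating_weight lab (- 1) d) (c d))"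
      using Suc by simp
    ultimately show ?case
      by (cases "even d") auto
  qed
  from this[OF order_refl]
  obtain s where "evaluate (alternating_weight lab s m) (c m) \<noteq> 0"
    by fastforce
  moreover have "evaluate w a = 0" if "\<And>\<sigma>. \<sigma> \<in> Poly_Mapping.keys a \<Longrightarrow> w \<sigma> = 0"
    for w and a :: "(nat \<Rightarrow> real) chain"
    using that by (simp add: evaluate_def frag_extend_eq_0)
  ultimately obtain \<sigma> where "\<sigma> \<in> Poly_Mapping.keys (c m)" "alternating_weight lab s m \<sigma> \<noteq> 0"
    by blast
  then show ?thesis
    by (auto simp: alternating_weight_def)
qed

section \<open>Fine antipodal towers on the sphere\<close>

lemma continuous_map_antipode: "continuous_map (nsphere n) (nsphere n) antipode"
  unfolding nsphere continuous_map_in_subtopology continuous_map_componentwise_UNIV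
  by (auto intro!: continuous_map_from_subtopology continuous_map_minus continuous_map_product_projection)

lemma chain_map_antipode_antipode:
  assumes "singular_chain p X c"
  shows "chain_map p antipode (chain_map p antipode c) = c"
proof -
  have "chain_map p antipode (chain_map p antipode c) = chain_map p (antipode \<circ> antipode) c"
    by (simp only: chain_map_compose comp_apply)
  also have "\<dots> = c"
    using assms by (rule chain_map_id_gen) (simp add: comp_def)
  finally show ?thesis .
qed

text \<open>
  In degree \<open>0\<close> it is the reduced homology group that vanishes, hence the condition that the
  coefficients of \<open>z\<close> add up to \<open>0\<close>, expressed by pushing \<open>z\<close> forward to a point.
\<close>

lemma singular_boundary_of_cycle_nsphere:
  assumes z: "singular_relcycle p (nsphere n) {} z" and "p < n"
    and aug: "p = 0 \<Longrightarrow> chain_map 0 (\<lambda>_. ()) z = 0"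
  shows "singular_relboundary p (nsphere n) {} z"
proof -
  let ?h = "homologous_rel_set p (nsphere n) {} z"
  have h: "?h \<in> carrier (homology_group p (nsphere n))"
    using z by (auto simp: carrier_relative_homology_group)
  have "?h \<in> carrier (reduced_homology_group p (nsphere n))"
  proof (cases "p = 0")
    case False
    with h show ?thesis by (simp add: un_reduced_homology_group)
  next
    case True
    have "hom_induced (int p) (nsphere n) {} (discrete_topology {()}) {} (\<lambda>_. ()) ?h =
        homologous_rel_set p (discrete_topology {()}) {} (chain_map p (\<lambda>_. ()) z)"
      using z by (intro hom_induced_chain_map) auto
    also have "\<dots> = singular_relboundary_set p (discrete_topology {()}) {}"
      using aug True by (simp add: homologous_rel_set_eq_relboundary)
    finally show ?thesis
      using h by (simp add: carrier_reduced_homology_group kernel_def)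
  qed
  moreover have "trivial_group (reduced_homology_group p (nsphere n))"
    using \<open>p < n\<close> by (intro reduced_homology_group_nsphere) simp
  ultimately have "?h = \<one>\<^bsub>homology_group p (nsphere n)\<^esub>"
    by (simp add: trivial_group_def one_reduced_homology_group)
  then show ?thesis
    by (simp add: homologous_rel_set_eq_relboundary)
qed

text \<open>
  The next chain exists because \<open>z = c m - (- 1) ^ m a(c m)\<close>, with \<open>a\<close> the antipodal map, is a cycle in a
  degree below \<open>n\<close>: applying the boundary to both terms and using that \<open>a\<close> is an involution, everything
  cancels.
\<close>

lemma antipodal_tower_exists:
  assumes "m \<le> n"
  shows "\<exists>c. antipodal_tower n m c"
  using assms
proof (induction m)
  case 0
  let ?\<sigma> = "restrict (\<lambda>_. vertex 0) (standard_simplex 0) :: (nat \<Rightarrow> real) \<Rightarrow> nat \<Rightarrow> real"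
  have "singular_simplex 0 (nsphere n) ?\<sigma>"
    using in_topspace_nsphere[of n] by (simp add: singular_simplex_def)
  then have "antipodal_tower n 0 (\<lambda>_. frag_of ?\<sigma>)"
    by (auto simp: antipodal_tower_def singular_chain_of)
  then show ?case by blast
next
  case (Suc m)
  then obtain c where c: "antipodal_tower n m c"
    by auto
  define z where "z = c m - frag_cmul ((- 1) ^ m) (chain_map m antipode (c m))"
  have cm: "singular_chain m (nsphere n) (c m)"
    using antipodal_towerD(1)[OF c] by simp
  then have acm: "singular_chain m (nsphere n) (chain_map m antipode (c m))"
    using continuous_map_antipode by (rule singular_chain_chain_map)
  have "chain_boundary m z = 0"
  proof (cases m)
    case 0
    then show ?thesis by (simp add: chain_boundary_def)
  next
    case (Suc k)
    have ck: "singular_chain k (nsphere n) (c k)"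
      using antipodal_towerD(1)[OF c] Suc by simp
    have "chain_boundary m (chain_map m antipode (c m)) =
        chain_map k antipode (chain_boundary m (c m))"
      using chain_boundary_chain_map[OF cm] Suc by simp
    moreover have "chain_boundary m (c m) =
        c k - frag_cmul ((- 1) ^ k) (chain_map k antipode (c k))"
      using antipodal_towerD(2)[OF c] Suc by simp
    ultimately show ?thesis
      unfolding z_def chain_boundary_diff chain_boundary_cmul Suc
      by (cases "even k") (simp_all add: chain_map_diff chain_map_add chain_map_antipode_antipode[OF ck])
  qed
  then have "singular_relcycle m (nsphere n) {} z"
    using cm acm by (simp add: singular_cycle z_def singular_chain_diff singular_chain_cmul)
  moreover have "chain_map 0 (\<lambda>_. ()) z = 0" if "m = 0"
  proof -
    obtain \<sigma> where "c 0 = frag_of \<sigma>"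
      using c by (auto simp: antipodal_tower_def)
    then show ?thesis
      using that by (simp add: z_def chain_map_diff simplex_map_def comp_def)
  qed
  ultimately have "singular_relboundary m (nsphere n) {} z"
    using Suc.prems by (intro singular_boundary_of_cycle_nsphere) auto
  then obtain d where d: "singular_chain (Suc m) (nsphere n) d" "chain_boundary (Suc m) d = z"
    by (auto simp: singular_boundary)
  have "antipodal_tower n (Suc m) (c(Suc m := d))"
    using c d by (auto simp: antipodal_tower_def z_def le_Suc_eq less_Suc_eq)
  then show ?case by blast
qed

text \<open>
  Subdivision is a natural chain map, so it commutes with the boundary and with the antipodal map.
\<close>

lemma antipodal_tower_subdivision:
  assumes "antipodal_tower n m c"
  shows "antipodal_tower n m (\<lambda>d. singular_subdivision d (c d))"
  unfolding antipodal_tower_def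
proof (intro conjI allI impI)
  obtain \<sigma> where "c 0 = frag_of \<sigma>"
    using assms by (auto simp: antipodal_tower_def)
  moreover have "singular_subdivision 0 (c 0) = c 0"
    using antipodal_towerD(1)[OF assms, of 0] by (auto intro: singular_subdivision_zero)
  ultimately show "\<exists>\<sigma>. singular_subdivision 0 (c 0) = frag_of \<sigma>"
    by auto
  show "singular_chain d (nsphere n) (singular_subdivision d (c d))" if "d \<le> m" for d
    using antipodal_towerD(1)[OF assms that] by (rule singular_chain_singular_subdivision)
  show "chain_boundary (Suc d) (singular_subdivision (Suc d) (c (Suc d))) =
      singular_subdivision d (c d) -
      frag_cmul ((- 1) ^ d) (chain_map d antipode (singular_subdivision d (c d)))"
    if "d < m" for d
  proof -
    have cd: "singular_chain d (nsphere n) (c d)" "singular_chain (Suc d) (nsphere n) (c (Suc d))"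
      using antipodal_towerD(1)[OF assms] that by auto
    have "singular_subdivision d (frag_cmul k x) = frag_cmul k (singular_subdivision d x)"
      for k and x :: "(nat \<Rightarrow> real) chain"
      by (simp add: singular_subdivision_def frag_extend_cmul)
    then show ?thesis
      using antipodal_towerD(2)[OF assms that] cd
      by (simp add: chain_boundary_singular_subdivision singular_subdivision_diff
          flip: naturality_singular_subdivision)
  qed
qed

lemma antipodal_tower_iterated_subdivision:
  assumes "antipodal_tower n m c"
  shows "antipodal_tower n m (\<lambda>d. (singular_subdivision d ^^ N) (c d))"
proof (induction N)
  case 0
  then show ?case using assms by simp
next
  case (Suc N)
  then show ?case
    using antipodal_tower_subdivision by fastforce
qed

text \<open>
  All chains of the tower must be subdivided equally often, so the largest of the finitely many
  required numbers of subdivisions is used.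
\<close>

lemma fine_antipodal_tower_exists:
  assumes open_cover: "\<And>U. U \<in> \<C> \<Longrightarrow> openin (nsphere n) U"
    and covers: "topspace (nsphere n) \<subseteq> \<Union>\<C>"
  obtains c where "antipodal_tower n n c"
    "\<And>d \<sigma>. d \<le> n \<Longrightarrow> \<sigma> \<in> Poly_Mapping.keys (c d) \<Longrightarrow> \<exists>U\<in>\<C>. \<sigma> \<in> standard_simplex d \<rightarrow> U"
proof -
  obtain c where c: "antipodal_tower n n c"
    using antipodal_tower_exists by blast
  have "\<exists>N. \<forall>M \<sigma>. N \<le> M \<longrightarrow> \<sigma> \<in> Poly_Mapping.keys ((singular_subdivision d ^^ M) (c d)) \<longrightarrow>
      (\<exists>U\<in>\<C>. \<sigma> \<in> standard_simplex d \<rightarrow> U)" if "d \<le> n" for d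
    using sufficient_iterated_singular_subdivision_exists
      [OF open_cover covers antipodal_towerD(1)[OF c that]] by metis
  then obtain N where N: "\<And>d M \<sigma>. d \<le> n \<Longrightarrow> N d \<le> M \<Longrightarrow>
      \<sigma> \<in> Poly_Mapping.keys ((singular_subdivision d ^^ M) (c d)) \<Longrightarrow>
      \<exists>U\<in>\<C>. \<sigma> \<in> standard_simplex d \<rightarrow> U"
    by metis
  define M where "M = Max (N ` {..n})"
  have "N d \<le> M" if "d \<le> n" for d
    using that by (auto simp: M_def)
  with N have "\<And>d \<sigma>. d \<le> n \<Longrightarrow> \<sigma> \<in> Poly_Mapping.keys ((singular_subdivision d ^^ M) (c d)) \<Longrightarrow>
      \<exists>U\<in>\<C>. \<sigma> \<in> standard_simplex d \<rightarrow> U"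
    by blast
  with antipodal_tower_iterated_subdivision[OF c, of M] show ?thesis
    using that by blast
qed

section \<open>The Borsuk--Ulam theorem\<close>

text \<open>
  If there is no common zero, label \<open>x\<close> by the least index \<open>k\<close> for which \<open>\<bar>g k x\<bar>\<close> is maximal, together with the
  sign of \<open>g k x\<close>. A fine antipodal tower with this labelling contradicts Ky Fan's lemma, as
  \<open>n + 1\<close> labels of distinct absolute values do not fit into \<open>{1..n}\<close>.
\<close>

theorem Borsuk_Ulam_nsphere:
  fixes g :: "nat \<Rightarrow> (nat \<Rightarrow> real) \<Rightarrow> real"
  assumes cont: "\<And>k. k < n \<Longrightarrow> continuous_map (nsphere n) euclideanreal (g k)"
    and odd: "\<And>k x. k < n \<Longrightarrow> x \<in> topspace (nsphere n) \<Longrightarrow> g k (antipode x) = - g k x"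
  shows "\<exists>x\<in>topspace (nsphere n). \<forall>k<n. g k x = 0"
proof (rule ccontr)
  assume "\<not> ?thesis"
  then have nonzero: "\<exists>k<n. g k x \<noteq> 0" if "x \<in> topspace (nsphere n)" for x
    using that by auto
  define dominant where "dominant x k \<longleftrightarrow> k < n \<and> (\<forall>j<n. \<bar>g j x\<bar> \<le> \<bar>g k x\<bar>)" for x k
  define ind where "ind x = (LEAST k. dominant x k)" for x
  \<comment> \<open>The shift by one keeps the index \<open>0\<close> from producing the signless label \<open>0\<close>.\<close>
  define lab where "lab x = (if g (ind x) x > 0 then 1 else - 1) * (int (ind x) + 1)" for x
  have ind: "dominant x (ind x)" if "x \<in> topspace (nsphere n)" for x
  proof -
    have "{..<n} \<noteq> {}"
      using nonzero[OF that] by auto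
    then have "Max ((\<lambda>k. \<bar>g k x\<bar>) ` {..<n}) \<in> (\<lambda>k. \<bar>g k x\<bar>) ` {..<n}"
      by (intro Max_in) auto
    then obtain k where "k < n" "\<bar>g k x\<bar> = Max ((\<lambda>k. \<bar>g k x\<bar>) ` {..<n})"
      by auto
    then have "dominant x k"
      by (auto simp: dominant_def)
    then show ?thesis
      unfolding ind_def by (rule LeastI)
  qed
  have ind_nz: "g (ind x) x \<noteq> 0" if "x \<in> topspace (nsphere n)" for x
    using nonzero[OF that] ind[OF that] unfolding dominant_def by fastforce
  have ind_antipode: "ind (antipode x) = ind x" if "x \<in> topspace (nsphere n)" for x
  proof -
    have "dominant (antipode x) = dominant x"
      using odd that by (auto simp: dominant_def fun_eq_iff)
    then show ?thesis by (simp add: ind_def)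
  qed
  have lab_antipode: "lab (antipode x) = - lab x" if "x \<in> topspace (nsphere n)" for x
    using ind_antipode[OF that] ind_nz[OF that] odd[OF _ that, of "ind x"] ind[OF that]
    by (auto simp: lab_def dominant_def)
  have lab_nz: "lab x \<noteq> 0" for x
    by (simp add: lab_def)
  have lab_range: "\<bar>lab x\<bar> \<in> {1..int n}" if "x \<in> topspace (nsphere n)" for x
    using ind[OF that] by (auto simp: lab_def dominant_def abs_mult)
  \<comment> \<open>On \<open>U y\<close> every coordinate stays within half the maximal modulus at \<open>y\<close> of its value at \<open>y\<close>;
    then a coordinate that is dominant at two points of \<open>U y\<close> has the same sign at both.\<close>
  define U where "U y = (\<Inter>k\<in>{..<n}. {x \<in> topspace (nsphere n). g k x \<in> ball (g k y) (\<bar>g (ind y) y\<bar> / 2)}) \<inter>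
      topspace (nsphere n)" for y
  have "openin (nsphere n) (U y)" if "y \<in> topspace (nsphere n)" for y
    unfolding U_def using cont
    by (intro openin_INT finite_lessThan openin_continuous_map_preimage) auto
  moreover have "y \<in> U y" if "y \<in> topspace (nsphere n)" for y
    using that ind_nz[OF that] by (auto simp: U_def)
  ultimately obtain c where tower: "antipodal_tower n n c" and
    small: "\<And>d \<sigma>. d \<le> n \<Longrightarrow> \<sigma> \<in> Poly_Mapping.keys (c d) \<Longrightarrow>
              \<exists>V\<in>U ` topspace (nsphere n). \<sigma> \<in> standard_simplex d \<rightarrow> V"
    by (rule_tac fine_antipodal_tower_exists[of "U ` topspace (nsphere n)" n]) auto
  have close: "lab x \<noteq> - lab x'" if y: "y \<in> topspace (nsphere n)" and xx': "x \<in> U y" "x' \<in> U y" for x x' y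
  proof
    assume eq: "lab x = - lab x'"
    then have "\<bar>lab x\<bar> = \<bar>lab x'\<bar>"
      by simp
    then have ind_eq: "ind x' = ind x"
      by (auto simp: lab_def split: if_split_asm)
    with eq have sign: "(g (ind x) x > 0) \<noteq> (g (ind x) x' > 0)"
      by (auto simp: lab_def split: if_splits)
    \<comment> \<open>On \<open>U y\<close> the coordinate dominant at \<open>y\<close> keeps more than half of its modulus at \<open>y\<close>, so the
      common dominant coordinate at \<open>x\<close> and \<open>x'\<close> exceeds that half too and therefore has the
      same sign as at \<open>y\<close>.\<close>
    have k: "dominant x (ind x)" "dominant x' (ind x)" and m: "dominant y (ind y)"
      using ind[of x] ind[of x'] ind[OF y] xx' ind_eq by (auto simp: U_def)
    have "dist (g k y) (g k x) < \<bar>g (ind y) y\<bar> / 2" "dist (g k y) (g k x') < \<bar>g (ind y) y\<bar> / 2"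
      if "k < n" for k
      using xx' that by (auto simp: U_def)
    then have "dist (g k y) (g k x) < \<bar>g (ind y) y\<bar> / 2 \<and> dist (g k y) (g k x') < \<bar>g (ind y) y\<bar> / 2"
      if "k \<in> {ind x, ind y}" for k
      using that k m by (auto simp: dominant_def)
    moreover have "\<bar>g (ind y) x\<bar> \<le> \<bar>g (ind x) x\<bar>" "\<bar>g (ind y) x'\<bar> \<le> \<bar>g (ind x) x'\<bar>"
      using k m by (auto simp: dominant_def)
    ultimately show False
      using sign unfolding dist_real_def by (smt (verit) field_sum_of_halves insertCI)
  qed
  have compl: "lab (\<sigma> (vertex i)) \<noteq> - lab (\<sigma> (vertex j))"
    if "d \<le> n" "\<sigma> \<in> Poly_Mapping.keys (c d)" "i \<le> d" "j \<le> d" for d \<sigma> i j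
  proof -
    have "\<exists>y\<in>topspace (nsphere n). \<sigma> \<in> standard_simplex d \<rightarrow> U y"
      using small[OF that(1,2)] by blast
    then obtain y where y: "y \<in> topspace (nsphere n)" "\<sigma> \<in> standard_simplex d \<rightarrow> U y"
      by blast
    then show ?thesis
      using close[OF y(1)] that(3,4) by (auto simp: Pi_iff)
  qed
  have "\<exists>\<sigma>\<in>Poly_Mapping.keys (c n). \<exists>s. alternating_family s {..n} (\<lambda>i. lab (\<sigma> (vertex i)))"
    by (rule antipodal_tower_has_alternating_simplex[OF tower]) (use lab_antipode lab_nz compl in auto)
  then obtain \<sigma> s where \<sigma>: "\<sigma> \<in> Poly_Mapping.keys (c n)"
    and alt: "alternating_family s {..n} (\<lambda>i. lab (\<sigma> (vertex i)))"
    by blast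
  have on_sphere: "\<sigma> (vertex i) \<in> topspace (nsphere n)" if "i \<le> n" for i
    using small[OF order_refl \<sigma>] that by (auto simp: Pi_iff U_def)
  have "inj_on (\<lambda>i. \<bar>lab (\<sigma> (vertex i))\<bar>) {..n}"
    using alt compl[OF order_refl \<sigma>]
    by (auto simp: alternating_family_def inj_on_def abs_eq_iff)
  then have "card {..n} \<le> card {1..int n}"
    using on_sphere lab_range by (intro card_inj_on_le) auto
  then show False by simp
qed

lemma topspace_nsphere_iff:
  "x \<in> topspace (nsphere n) \<longleftrightarrow> (\<Sum>i\<le>n. (x i)\<^sup>2) = 1 \<and> (\<forall>i>n. x i = 0)"
  by (simp add: nsphere)

text \<open>
  The general form follows along the odd isometric embedding that sends the coordinates of a point of
  \<open>nsphere n\<close> to coordinates with respect to \<open>Basis\<close>.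
\<close>

theorem Borsuk_Ulam:
  fixes g :: "'a::euclidean_space \<Rightarrow> 'b::euclidean_space"
  assumes dim: "DIM('a) = Suc DIM('b)"
    and cont: "continuous_on (sphere 0 1) g"
    and odd: "\<And>x. x \<in> sphere 0 1 \<Longrightarrow> g (- x) = - g x"
  obtains x where "x \<in> sphere 0 1" "g x = 0"
proof -
  define n where "n = DIM('b)"
  obtain a :: "nat \<Rightarrow> 'a" where a: "bij_betw a {..n} Basis"
    using ex_bij_betw_nat_finite[of "Basis :: 'a set"] 
    by (auto simp: dim n_def atLeast0LessThan lessThan_Suc_atMost)
  obtain b :: "nat \<Rightarrow> 'b" where b: "bij_betw b {..<n} Basis"
    using ex_bij_betw_nat_finite[of "Basis :: 'b set"]
    by (auto simp: n_def atLeast0LessThan)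
  define emb where "emb x = (\<Sum>i\<le>n. x i *\<^sub>R a i)" for x
  have emb_sphere: "emb x \<in> sphere 0 1" if "x \<in> topspace (nsphere n)" for x
  proof -
    have inj: "inj_on a {..n}" and Basis: "a ` {..n} = Basis"
      using a by (auto simp: bij_betw_def)
    have "emb x \<bullet> a j = x j" if "j \<le> n" for j
    proof -
      have "emb x \<bullet> a j = (\<Sum>i\<le>n. if i = j then x j else 0)"
        unfolding emb_def inner_sum_left
      proof (intro sum.cong refl)
        fix i assume "i \<in> {..n}"
        then have "a i \<in> Basis" "a j \<in> Basis" "a i = a j \<longleftrightarrow> i = j"
          using Basis inj that by (auto simp: inj_on_def)
        then show "x i *\<^sub>R a i \<bullet> a j = (if i = j then x j else 0)"
          by (simp add: inner_Basis)
      qed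
      then show ?thesis using that by simp
    qed
    moreover have "emb x \<bullet> emb x = (\<Sum>u\<in>Basis. (emb x \<bullet> u)\<^sup>2)"
      by (simp add: euclidean_inner[of "emb x" "emb x"] power2_eq_square)
    ultimately have "emb x \<bullet> emb x = (\<Sum>i\<le>n. (x i)\<^sup>2)"
      by (simp add: sum.reindex[OF inj] flip: Basis)
    then show ?thesis
      using that by (simp add: norm_eq_sqrt_inner topspace_nsphere_iff)
  qed
  have emb_cont: "continuous_map (nsphere n) (top_of_set (sphere 0 1)) emb"
    unfolding continuous_map_in_subtopology
  proof
    show "continuous_map (nsphere n) euclidean emb"
      unfolding emb_def
    proof (intro continuous_map_sum)
      fix i
      have "continuous_map euclideanreal euclidean (\<lambda>t. t *\<^sub>R a i)"
        by (auto intro!: continuous_intros)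
      from continuous_map_compose[OF continuous_map_nsphere_projection this]
      show "continuous_map (nsphere n) euclidean (\<lambda>x. x i *\<^sub>R a i)"
        by (simp add: comp_def)
    qed auto
  qed (use emb_sphere in auto)
  have "\<exists>x\<in>topspace (nsphere n). \<forall>k<n. g (emb x) \<bullet> b k = 0"
  proof (rule Borsuk_Ulam_nsphere)
    fix k assume "k < n"
    have "continuous_map (top_of_set (sphere 0 1)) euclideanreal (\<lambda>x. g x \<bullet> b k)"
      using cont by (auto intro!: continuous_intros)
    from continuous_map_compose[OF emb_cont this]
    show "continuous_map (nsphere n) euclideanreal (\<lambda>x. g (emb x) \<bullet> b k)"
      by (simp add: comp_def)
  next
    fix k x assume "x \<in> topspace (nsphere n)"
    then show "g (emb (antipode x)) \<bullet> b k = - (g (emb x) \<bullet> b k)"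
      using odd[OF emb_sphere] by (simp add: emb_def sum_negf)
  qed
  then obtain x where x: "x \<in> topspace (nsphere n)" "\<And>k. k < n \<Longrightarrow> g (emb x) \<bullet> b k = 0"
    by blast
  have "g (emb x) \<bullet> u = 0" if "u \<in> Basis" for u
  proof -
    have "u \<in> b ` {..<n}"
      using that b by (auto simp: bij_betw_def)
    then show ?thesis using x(2) by auto
  qed
  then have "g (emb x) = 0"
    using euclidean_eqI[of "g (emb x)" 0] by simp
  with emb_sphere[OF x(1)] show ?thesis
    by (rule that)
qed

section \<open>Oscillation over half-space slices\<close>

text \<open>
  The value \<open>0\<close> on the empty set is what makes the spread over a slice of a strictly convex body
  depend continuously on the cutting hyperplane.
\<close>

definition spread :: "'a set \<Rightarrow> ('a \<Rightarrow> real) \<Rightarrow> real" where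
  "spread S g = (if S = {} then 0 else max_on S g - min_on S g)"

context
  fixes S :: "'a::topological_space set" and g :: "'a \<Rightarrow> real"
  assumes compact: "compact S" and cont: "continuous_on S g"
begin

lemma spread_attained:
  assumes "S \<noteq> {}"
  obtains x y where "x \<in> S" "y \<in> S" "spread S g = g x - g y" "\<forall>z\<in>S. g y \<le> g z \<and> g z \<le> g x"
proof -
  obtain x where x: "x \<in> S" "\<And>z. z \<in> S \<Longrightarrow> g z \<le> g x"
    using continuous_attains_sup[OF compact assms cont] by auto
  obtain y where y: "y \<in> S" "\<And>z. z \<in> S \<Longrightarrow> g y \<le> g z"
    using continuous_attains_inf[OF compact assms cont] by auto
  have "spread S g = g x - g y"
    using max_on_eqI[of x S g] min_on_eqI[of y S g] x y assms by (simp add: spread_def)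
  with x y show ?thesis
    by (intro that) auto
qed

lemma diff_le_spread:
  assumes "x \<in> S" "y \<in> S"
  shows "g x - g y \<le> spread S g"
proof -
  have "S \<noteq> {}"
    using assms by blast
  then obtain x' y' where xy': "spread S g = g x' - g y'" "\<forall>z\<in>S. g y' \<le> g z \<and> g z \<le> g x'"
    by (rule spread_attained)
  with assms show ?thesis
    by (auto intro: diff_mono)
qed

lemma spread_nonneg: "0 \<le> spread S g"
proof (cases "S = {}")
  case True
  then show ?thesis by (simp add: spread_def)
next
  case False
  then obtain x where "x \<in> S" by blast
  then show ?thesis
    using diff_le_spread[of x x] by simp
qed

lemma less_spread_iff:
  assumes "0 \<le> c"
  shows "c < spread S g \<longleftrightarrow> (\<exists>x\<in>S. \<exists>y\<in>S. c < g x - g y)"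
proof
  assume less: "c < spread S g"
  then have "S \<noteq> {}"
    using assms by (auto simp: spread_def)
  then obtain x y where "x \<in> S" "y \<in> S" "spread S g = g x - g y"
    by (rule spread_attained)
  with less show "\<exists>x\<in>S. \<exists>y\<in>S. c < g x - g y"
    by auto
next
  assume "\<exists>x\<in>S. \<exists>y\<in>S. c < g x - g y"
  then obtain x y where "x \<in> S" "y \<in> S" "c < g x - g y"
    by blast
  with diff_le_spread[of x y] show "c < spread S g"
    by linarith
qed

lemma le_spread_iff:
  assumes "0 < c"
  shows "c \<le> spread S g \<longleftrightarrow> (\<exists>x\<in>S. \<exists>y\<in>S. c \<le> g x - g y)"
proof
  assume le: "c \<le> spread S g"
  then have "S \<noteq> {}"
    using assms by (auto simp: spread_def)
  then obtain x y where "x \<in> S" "y \<in> S" "spread S g = g x - g y"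
    by (rule spread_attained)
  with le show "\<exists>x\<in>S. \<exists>y\<in>S. c \<le> g x - g y"
    by auto
next
  assume "\<exists>x\<in>S. \<exists>y\<in>S. c \<le> g x - g y"
  then obtain x y where "x \<in> S" "y \<in> S" "c \<le> g x - g y"
    by blast
  with diff_le_spread[of x y] show "c \<le> spread S g"
    by linarith
qed

lemma spread_uminus: "spread S (\<lambda>x. - g x) = spread S g"
proof (cases "S = {}")
  case False
  then obtain x y where xy: "x \<in> S" "y \<in> S" "spread S g = g x - g y"
    "\<forall>z\<in>S. g y \<le> g z \<and> g z \<le> g x"
    by (rule spread_attained)
  then have "max_on S (\<lambda>x. - g x) = - g y" "min_on S (\<lambda>x. - g x) = - g x"
    using xy max_on_eqI[of y S "\<lambda>x. - g x"] min_on_eqI[of x S "\<lambda>x. - g x"] by auto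
  then show ?thesis
    using False xy(3) by (simp add: spread_def)
qed (simp add: spread_def)

lemma spread_eq_0_imp_constant_on:
  assumes "spread S g = 0"
  shows "g constant_on S"
proof -
  have "g x = g y" if "x \<in> S" "y \<in> S" for x y
    using diff_le_spread[OF that] diff_le_spread[OF that(2,1)] assms by simp
  then show ?thesis
    unfolding constant_on_def by blast
qed

end

lemma closed_pos_halfspace: "closed (pos_halfspace u)"
  unfolding pos_halfspace_def by (intro closed_Collect_le continuous_intros)

lemma neg_halfspace_eq: "neg_halfspace u = pos_halfspace (- u)"
  by (auto simp: pos_halfspace_def neg_halfspace_def)

lemma pos_Un_neg_halfspace: "pos_halfspace u \<union> neg_halfspace u = UNIV"
  by (auto simp: pos_halfspace_def neg_halfspace_def)

text \<open>
  If \<open>A\<close> had no point strictly inside the half-space, the bounding hyperplane would support \<open>A\<close> at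
  \<open>x\<close>, and the slice, being \<open>A\<close> intersected with this hyperplane, would be the single point \<open>x\<close>. The
  condition \<open>u \<noteq> 0\<close> serves to exclude a degenerate hyperplane: if \<open>fst u = 0\<close>, then
  \<open>fst u \<bullet> x = snd u\<close> forces \<open>snd u = 0\<close> as well.
\<close>

lemma exists_strictly_inside_pos_halfspace:
  fixes A :: "(real ^ 'n) set"
  assumes supporting: "\<forall>x\<in>frontier A. \<forall>H. supporting_hyperplane A x H \<longrightarrow> is_singleton (A \<inter> H)"
    and "u \<noteq> 0"
    and xy: "x \<in> A \<inter> pos_halfspace u" "y \<in> A \<inter> pos_halfspace u" "x \<noteq> y"
  shows "\<exists>z\<in>A. snd u < fst u \<bullet> z"
proof (rule ccontr)
  assume "\<not> ?thesis"
  then have le: "fst u \<bullet> z \<le> snd u" if "z \<in> A" for z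
    using that by (auto simp: not_less)
  have eq: "fst u \<bullet> x = snd u" "fst u \<bullet> y = snd u"
    using xy le by (auto simp: pos_halfspace_def intro: antisym)
  then have "fst u \<noteq> 0"
    using \<open>u \<noteq> 0\<close> by (metis inner_zero_left prod.collapse zero_prod_def)
  define H where "H = {z. fst u \<bullet> z = snd u}"
  have "interior A \<subseteq> interior {z. fst u \<bullet> z \<le> snd u}"
    using le by (intro interior_mono) auto
  then have "x \<notin> interior A"
    using \<open>fst u \<noteq> 0\<close> eq by auto
  then have "x \<in> frontier A"
    using xy(1) closure_subset by (auto simp: frontier_def)
  moreover have "supporting_hyperplane A x H"
    unfolding supporting_hyperplane_def
    using \<open>fst u \<noteq> 0\<close> xy(1) eq le by (intro exI[of _ "fst u"] exI[of _ "snd u"]) (auto simp: H_def)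
  ultimately have "is_singleton (A \<inter> H)"
    using supporting by blast
  moreover have "x \<in> A \<inter> H" "y \<in> A \<inter> H"
    using xy eq by (auto simp: H_def)
  ultimately show False
    using \<open>x \<noteq> y\<close> by (metis is_singletonE singletonD)
qed

text \<open>
  The two halves of continuity have different reasons. The set where the spread is at least
  \<open>c > 0\<close> is the projection to the sphere of a compact set of triples \<open>(x, y, u)\<close> in which \<open>x\<close> and \<open>y\<close>
  witness the inequality, hence closed. The set where it exceeds \<open>c \<ge> 0\<close> is open because the two witnesses are distinct points of
  the slice, which therefore contains a point strictly inside the half-space; moving both
  witnesses slightly towards that point puts them strictly inside as well, and then they remain in the
  slice for all nearby \<open>u\<close>.
\<close>

lemma continuous_on_spread_pos_halfspace:
  fixes A :: "(real ^ 'n) set" and f :: "real ^ 'n \<Rightarrow> (real ^ 'n) \<times> real \<Rightarrow> real"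
  assumes compact: "compact A" and convex: "convex A"
    and supporting: "\<forall>x\<in>frontier A. \<forall>H. supporting_hyperplane A x H \<longrightarrow> is_singleton (A \<inter> H)"
    and cont: "continuous_on (A \<times> sphere 0 1) (\<lambda>(x, u). f x u)"
  shows "continuous_on (sphere 0 1) (\<lambda>u. spread (A \<inter> pos_halfspace u) (\<lambda>x. f x u))"
proof -
  define S :: "((real ^ 'n) \<times> real) set" where "S = sphere 0 1"
  define h where "h u = spread (A \<inter> pos_halfspace u) (\<lambda>x. f x u)" for u
  have cont_f: "continuous_on T (\<lambda>t. f (a t) (b t))"
    if "continuous_on T a" "continuous_on T b" "a ` T \<subseteq> A" "b ` T \<subseteq> S"
    for T :: "'b::topological_space set" and a b
    using continuous_on_compose2[OF cont continuous_on_Pair[OF that(1,2)]] that(3,4)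
    by (auto simp: S_def)
  have cont_in_x: "continuous_on A (\<lambda>x. f x u)" if "u \<in> S" for u
    using that by (intro cont_f continuous_intros) auto
  have cont_in_u: "continuous_on S (\<lambda>u. f x u)" if "x \<in> A" for x
    using that by (intro cont_f continuous_intros) auto
  have slice: "compact (A \<inter> pos_halfspace u)" "continuous_on (A \<inter> pos_halfspace u) (\<lambda>x. f x u)"
    if "u \<in> S" for u
    using compact_Int_closed[OF compact closed_pos_halfspace] continuous_on_subset[OF cont_in_x[OF that]]
    by blast+
  have upper: "closedin (top_of_set S) {u \<in> S. c \<le> h u}" for c
  proof (cases "c > 0")
    case False
    then have "{u \<in> S. c \<le> h u} = S"
      using spread_nonneg[OF slice] by (force simp: h_def)
    then show ?thesis by simp
  next
    case True
    let ?K = "(A \<times> A) \<times> S"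
    have K: "compact ?K"
      using compact by (intro compact_Times) (auto simp: S_def)
    have cont1: "continuous_on ?K (\<lambda>p. f (fst (fst p)) (snd p))"
      by (intro cont_f continuous_intros) auto
    have cont2: "continuous_on ?K (\<lambda>p. f (snd (fst p)) (snd p))"
      by (intro cont_f continuous_intros) auto
    let ?G = "{p \<in> ?K. snd (snd p) \<le> fst (snd p) \<bullet> fst (fst p)} \<inter>
              {p \<in> ?K. snd (snd p) \<le> fst (snd p) \<bullet> snd (fst p)} \<inter>
              {p \<in> ?K. c \<le> f (fst (fst p)) (snd p) - f (snd (fst p)) (snd p)}"
    have "closed ?G"
      using compact_imp_closed[OF K] cont1 cont2
      by (intro closed_Int continuous_on_closed_Collect_le continuous_intros)
    then have "compact (?K \<inter> ?G)"
      using K by (intro compact_Int_closed)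
    then have "compact (snd ` (?K \<inter> ?G))"
      by (intro compact_continuous_image continuous_intros)
    moreover have "snd ` (?K \<inter> ?G) = {u \<in> S. c \<le> h u}"
    proof (intro equalityI subsetI)
      fix u assume "u \<in> snd ` (?K \<inter> ?G)"
      then obtain x y where "u \<in> S" "x \<in> A \<inter> pos_halfspace u" "y \<in> A \<inter> pos_halfspace u"
        "c \<le> f x u - f y u"
        by (auto simp: pos_halfspace_def)
      then show "u \<in> {u \<in> S. c \<le> h u}"
        unfolding h_def using le_spread_iff[OF slice True, of u] by blast
    next
      fix u assume "u \<in> {u \<in> S. c \<le> h u}"
      then obtain x y where u: "u \<in> S" and xy: "x \<in> A \<inter> pos_halfspace u" "y \<in> A \<inter> pos_halfspace u"
        "c \<le> f x u - f y u"
        unfolding h_def using le_spread_iff[OF slice True, of u] by blast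
      then have "((x, y), u) \<in> ?K \<inter> ?G"
        by (auto simp: pos_halfspace_def)
      then show "u \<in> snd ` (?K \<inter> ?G)"
        by (metis (no_types, lifting) image_eqI snd_conv)
    qed
    ultimately have "closed {u \<in> S. c \<le> h u}"
      by (simp only: compact_imp_closed)
    then show ?thesis
      by (rule closed_subset[rotated]) auto
  qed
  have lower: "openin (top_of_set S) {u \<in> S. c < h u}" for c
  proof (cases "c \<ge> 0")
    case False
    then have "{u \<in> S. c < h u} = S"
      using spread_nonneg[OF slice] by (force simp: h_def)
    then show ?thesis by simp
  next
    case True
    define W where "W x y = {u \<in> S. 0 < fst u \<bullet> x - snd u} \<inter> {u \<in> S. 0 < fst u \<bullet> y - snd u} \<inter>
        {u \<in> S. c < f x u - f y u}" for x y
    have "openin (top_of_set S) (W x y)" if "x \<in> A" "y \<in> A" for x y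
    proof -
      have pre: "openin (top_of_set S) {u \<in> S. a < k u}" if "continuous_on S k" for a and k :: "_ \<Rightarrow> real"
        using continuous_openin_preimage_gen[OF that open_greaterThan[of a]] by (simp add: vimage_def Int_def)
      show ?thesis
        unfolding W_def using that
        by (intro openin_Int pre continuous_intros cont_in_u)
    qed
    moreover have "{u \<in> S. c < h u} = (\<Union>x\<in>A. \<Union>y\<in>A. W x y)"
    proof (intro equalityI subsetI)
      fix u assume "u \<in> (\<Union>x\<in>A. \<Union>y\<in>A. W x y)"
      then show "u \<in> {u \<in> S. c < h u}"
      proof (safe)
        fix x y assume "x \<in> A" "y \<in> A" "u \<in> W x y"
        then have u: "u \<in> S" and "x \<in> A \<inter> pos_halfspace u" "y \<in> A \<inter> pos_halfspace u" "c < f x u - f y u"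
          by (auto simp: W_def pos_halfspace_def)
        then show "u \<in> S" "c < h u"
          unfolding h_def using less_spread_iff[OF slice True, of u] by blast+
      qed
    next
      fix u assume "u \<in> {u \<in> S. c < h u}"
      then have u: "u \<in> S" "c < h u"
        by auto
      then obtain x y where x: "x \<in> A \<inter> pos_halfspace u" and y: "y \<in> A \<inter> pos_halfspace u"
        and xy: "c < f x u - f y u"
        unfolding h_def using less_spread_iff[OF slice True, of u] by blast
      have "x \<noteq> y"
        using xy True by auto
      moreover have "u \<noteq> 0"
        using u by (auto simp: S_def)
      ultimately obtain z where z: "z \<in> A" "snd u < fst u \<bullet> z"
        using exists_strictly_inside_pos_halfspace[OF supporting _ x y] by blast
      define path where "path w t = (1 - t) *\<^sub>R w + t *\<^sub>R z" for w t
      have path_A: "path w t \<in> A" if "w \<in> A" "t \<in> {0..1}" for w t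
        using that z convex by (auto simp: path_def convex_alt)
      have path_strict: "0 < fst u \<bullet> path w t - snd u" if "w \<in> pos_halfspace u" "0 < t" "t < 1" for w t
      proof -
        have "0 \<le> (1 - t) * (fst u \<bullet> w - snd u)" "0 < t * (fst u \<bullet> z - snd u)"
          using that z by (auto simp: pos_halfspace_def)
        then show ?thesis
          by (simp add: path_def inner_right_distrib algebra_simps)
      qed
      have "continuous_on {0..1} (\<lambda>t. f (path w t) u)" if "w \<in> A" for w
        using path_A[OF that] u(1)
        by (intro continuous_on_compose2[OF cont_in_x]) (auto simp: path_def intro!: continuous_intros)
      then have "continuous_on {0..1} (\<lambda>t. f (path x t) u - f (path y t) u)"
        using x y by (auto intro!: continuous_intros)
      then have "((\<lambda>t. f (path x t) u - f (path y t) u) \<longlongrightarrow> f (path x 0) u - f (path y 0) u) (at_right 0)"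
        by (force simp: continuous_on_def at_within_Icc_at_right[of 0 1, symmetric])
      moreover have "c < f (path x 0) u - f (path y 0) u"
        using xy by (simp add: path_def)
      ultimately have "\<forall>\<^sub>F t in at_right 0. c < f (path x t) u - f (path y t) u"
        by (rule order_tendstoD)
      moreover have "\<forall>\<^sub>F t in at_right 0. t \<in> {0<..<1::real}"
        by (rule eventually_at_right_real) simp
      ultimately have "\<forall>\<^sub>F t in at_right 0. c < f (path x t) u - f (path y t) u \<and> t \<in> {0<..<1}"
        by (rule eventually_conj)
      then obtain t where t: "c < f (path x t) u - f (path y t) u" "0 < t" "t < 1"
        using eventually_happens'[OF trivial_limit_at_right_real] by fastforce
      then have "u \<in> W (path x t) (path y t)" "path x t \<in> A" "path y t \<in> A"
        using u(1) x y path_strict path_A by (auto simp: W_def)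
      then show "u \<in> (\<Union>x\<in>A. \<Union>y\<in>A. W x y)"
        by blast
    qed
    ultimately show ?thesis
      by auto
  qed
  have "continuous_map (top_of_set S) euclideanreal h"
    unfolding continuous_map_upper_lower_semicontinuous_lt
  proof (intro conjI allI)
    fix a
    have "{u \<in> S. h u < a} = S - {u \<in> S. a \<le> h u}"
      by auto
    then show "openin (top_of_set S) {u \<in> topspace (top_of_set S). h u < a}"
      using openin_diff[OF openin_topspace upper[of a]] by simp
  qed (use lower in simp)
  then show ?thesis
    by (simp add: S_def h_def)
qed

section \<open>Equal oscillation on both sides of a hyperplane\<close>

theorem theorem3p1:
  fixes A :: "'n::finite \<Rightarrow> (real ^ 'n) set"
    and f :: "'n \<Rightarrow> real ^ 'n \<Rightarrow> (real ^ 'n) \<times> real \<Rightarrow> real"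
  assumes compact: "\<And>i. compact (A i)"
    and convex: "\<And>i. convex (A i)"
    and interior: "\<And>i. interior (A i) \<noteq> {}"
    and continuous: "\<And>i. continuous_on (UNIV \<times> sphere 0 1) (\<lambda>(x, u). f i x u)"
    and supporting: "\<And>i x H. x \<in> frontier (A i) \<Longrightarrow> supporting_hyperplane (A i) x H
                        \<Longrightarrow> is_singleton (A i \<inter> H)"
    and odd: "\<And>i x u. u \<in> sphere 0 1 \<Longrightarrow> f i x (- u) = - f i x u"
  shows "\<exists>u \<in> sphere 0 1. \<forall>i.
     (A i \<inter> pos_halfspace u \<noteq> {} \<and> A i \<inter> neg_halfspace u \<noteq> {} \<and>
      max_on (A i \<inter> pos_halfspace u) (\<lambda>x. f i x u) - min_on (A i \<inter> pos_halfspace u) (\<lambda>x. f i x u)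
      = max_on (A i \<inter> neg_halfspace u) (\<lambda>x. f i x u) - min_on (A i \<inter> neg_halfspace u) (\<lambda>x. f i x u))
     \<or>
     ((A i \<inter> pos_halfspace u = {} \<and> A i \<inter> neg_halfspace u = A i \<or>
       A i \<inter> neg_halfspace u = {} \<and> A i \<inter> pos_halfspace u = A i) \<and>
      (\<lambda>x. f i x u) constant_on A i)"
proof -
  define h where "h i u = spread (A i \<inter> pos_halfspace u) (\<lambda>x. f i x u)" for i u
  define g :: "(real ^ 'n) \<times> real \<Rightarrow> real ^ 'n" where "g u = (\<chi> i. h i u - h i (- u))" for u
  have slice: "compact (A i \<inter> pos_halfspace v)" "continuous_on (A i \<inter> pos_halfspace v) (\<lambda>x. f i x u)"
    if "u \<in> sphere 0 1" for i u v
  proof -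
    show "compact (A i \<inter> pos_halfspace v)"
      using compact closed_pos_halfspace by (rule compact_Int_closed)
    show "continuous_on (A i \<inter> pos_halfspace v) (\<lambda>x. f i x u)"
      using continuous_on_compose2[OF continuous, of "A i \<inter> pos_halfspace v" "\<lambda>x. (x, u)" i] that
      by (simp add: continuous_on_Pair image_subset_iff)
  qed
  have h_uminus: "h i (- u) = spread (A i \<inter> neg_halfspace u) (\<lambda>x. f i x u)" if "u \<in> sphere 0 1" for i u
    using spread_uminus[OF slice[OF that]] odd[OF that] by (simp add: h_def neg_halfspace_eq)
  have cont_h: "continuous_on (sphere 0 1) (h i)" for i
    unfolding h_def using supporting
    by (intro continuous_on_spread_pos_halfspace compact convex continuous_on_subset[OF continuous]) auto
  have "- u \<in> sphere 0 1" if "u \<in> sphere 0 1" for u :: "(real ^ 'n) \<times> real"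
    using that by simp
  then have "continuous_on (sphere 0 1) (\<lambda>u. h i (- u))" for i
    by (intro continuous_on_compose2[OF cont_h] continuous_intros image_subsetI)
  with cont_h have "continuous_on (sphere 0 1) g"
    unfolding g_def by (intro continuous_on_vec_lambda continuous_on_diff)
  moreover have "g (- u) = - g u" for u
    by (simp add: g_def vec_eq_iff)
  moreover have "DIM((real ^ 'n) \<times> real) = Suc DIM(real ^ 'n)"
    by simp
  ultimately obtain u where u: "u \<in> sphere 0 1" "g u = 0"
    using Borsuk_Ulam by blast
  show ?thesis
  proof (intro bexI[OF _ u(1)] allI)
    fix i
    let ?P = "A i \<inter> pos_halfspace u" and ?N = "A i \<inter> neg_halfspace u"
    have "h i u = h i (- u)"
      using u(2) by (simp add: g_def vec_eq_iff)
    then have balanced: "spread ?P (\<lambda>x. f i x u) = spread ?N (\<lambda>x. f i x u)"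
      using h_uminus[OF u(1)] by (simp add: h_def)
    have cover: "?P \<union> ?N = A i"
      using pos_Un_neg_halfspace[of u] by blast
    show "(?P \<noteq> {} \<and> ?N \<noteq> {} \<and>
        max_on ?P (\<lambda>x. f i x u) - min_on ?P (\<lambda>x. f i x u) =
        max_on ?N (\<lambda>x. f i x u) - min_on ?N (\<lambda>x. f i x u)) \<or>
       ((?P = {} \<and> ?N = A i \<or> ?N = {} \<and> ?P = A i) \<and> (\<lambda>x. f i x u) constant_on A i)"
    proof (cases "?P = {} \<or> ?N = {}")
      case False
      with balanced show ?thesis by (simp add: spread_def)
    next
      case True
      have "spread S k = 0" if "S = {}" for S :: "(real ^ 'n) set" and k
        using that by (simp add: spread_def)
      with True have "spread ?P (\<lambda>x. f i x u) = 0 \<or> spread ?N (\<lambda>x. f i x u) = 0"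
        by blast
      with balanced have "spread ?P (\<lambda>x. f i x u) = 0" "spread ?N (\<lambda>x. f i x u) = 0"
        by simp_all
      then have "(\<lambda>x. f i x u) constant_on ?P" "(\<lambda>x. f i x u) constant_on ?N"
        using spread_eq_0_imp_constant_on[OF slice[OF u(1)]] by (simp_all add: neg_halfspace_eq)
      with True cover show ?thesis
        by (cases "?P = {}") auto
    qed
  qed
qed

end
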